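(* Let $p$ be a prime with $p\equiv 1$ or $3 \pmod 8$, and let $\left(\frac{\cdot}{p}\right)$ denote the Legendre symbol. Put $$A=\frac12\sum_{x=0}^{p-1}\left(\frac{x^3+4x^2+2x}{p}\right).$$ (1) If $p\equiv 1\pmod 8$ and $n$ is a quadratic nonresidue modulo $p$, put $$B=\frac14\sum_{x=0}^{p-1}\left(\frac{x^5+nx}{p}\right).$$ (2) If $p\equiv 3\pmod 8$, put $$B=\frac14\left(1+\sum_{x=0}^{p-1}\left(\frac{x^6+4x^5+10x^4-20x^2-16x-8}{p}\right)\right).$$ Then $A$ and $B$ are integers and $A^2+2B^2=p$. *)

theory Defs
  imports Complex_Main "HOL-Number_Theory.Number_Theory"
begin

end

theory Submission
  imports Defs
begin

text \<open>
  Both cases are treated at once in the ring R = (Z/p)[sqrt 2], which is a field for p = 3 (mod 8)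
  and a product of two prime fields for p = 1 (mod 8); write chi for the Legendre symbol, N for the
  norm, and note chi(-2) = 1. For c in R let W(c) be the sum of chi(N(z) Re(c z^4)) over z in R.
  Then W(t c) = chi(t) W(c) for t in Z/p, W(c w^4) = chi(N w) W(c) for units w, and W is invariant
  under conjugation. Hence W(c)^2 takes only three values on units: W(c0)^2 if N(c) is a nonresidue,
  and W(1)^2 or 0, equally often, if N(c) is a residue. Averaging W(c)^2 over all c with the
  orthogonality of chi(Re(c u)) and chi(Re c) gives W(1)^2 + 2 W(c0)^2 = 16 p (p - 1)^2, as there are
  four lines of u with u^4 in Z/p. Dehomogenising, W(1) = 4 (p - 1) A, while for suitable c0 of
  nonresidue norm W(c0) is, up to sign, 4 (p - 1) B: for p = 3 (mod 8) because the sextic is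
  N(z) Re((2 + sqrt 2) z^4) / 2 at z = x + sqrt 2, and for p = 1 (mod 8) because R splits and
  N(z) Re(c0 z^4) becomes u v (u^4 + n v^4) up to a constant. So A^2 + 2 B^2 = p, and integrality
  follows from this equation by parity.
\<close>

lemma sum_reindex_retract:
  fixes f :: "'a \<Rightarrow> 'b::comm_monoid_add"
  assumes fin: "finite S"
    and red: "\<And>x. red x \<in> S" "\<And>x. x \<in> S \<Longrightarrow> red x = x"
    and f: "\<And>x. f (red x) = f x"
    and h: "\<And>x. red (h (red x)) = red (h x)"
    and surj: "\<And>y. y \<in> S \<Longrightarrow> \<exists>x. red (h x) = y"
  shows "(\<Sum>x\<in>S. f (h x)) = (\<Sum>x\<in>S. f x)"
proof -
  let ?g = "\<lambda>x. red (h x)"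
  have "?g ` S = S"
    using red h surj by (auto simp: image_iff) metis
  then have "bij_betw ?g S S"
    by (metis bij_betw_def eq_card_imp_inj_on fin)
  then have "(\<Sum>x\<in>S. f (?g x)) = (\<Sum>x\<in>S. f x)"
    by (rule sum.reindex_bij_betw)
  then show ?thesis
    by (simp add: f)
qed

datatype zsqrt2 = ZSqrt2 (re: int) (im: int)

lemma zsqrt2_eq_iff: "z = w \<longleftrightarrow> re z = re w \<and> im z = im w"
  by (auto intro: zsqrt2.expand)

instantiation zsqrt2 :: comm_ring_1
begin

definition "0 = ZSqrt2 0 0"
definition "1 = ZSqrt2 1 0"
definition "z + w = ZSqrt2 (re z + re w) (im z + im w)"
definition "z - w = ZSqrt2 (re z - re w) (im z - im w)"
definition "- z = ZSqrt2 (- re z) (- im z)"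
definition "z * w = ZSqrt2 (re z * re w + 2 * im z * im w) (re z * im w + im z * re w)"

lemma zsqrt2_sel [simp]:
  "re 0 = 0" "im 0 = 0" "re 1 = 1" "im 1 = 0"
  "re (z + w) = re z + re w" "im (z + w) = im z + im w"
  "re (z - w) = re z - re w" "im (z - w) = im z - im w"
  "re (- z) = - re z" "im (- z) = - im z"
  "re (z * w) = re z * re w + 2 * im z * im w" "im (z * w) = re z * im w + im z * re w"
  by (simp_all add: zero_zsqrt2_def one_zsqrt2_def plus_zsqrt2_def minus_zsqrt2_def
      uminus_zsqrt2_def times_zsqrt2_def)

instance
  by standard (auto simp: zsqrt2_eq_iff algebra_simps)

end

lemma re_of_int [simp]: "re (of_int t) = t" and im_of_int [simp]: "im (of_int t) = 0"
proof -
  have "re (of_nat n) = int n \<and> im (of_nat n) = 0" for n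
    by (induction n) auto
  then show "re (of_int t) = t" "im (of_int t) = 0"
    by (cases t rule: int_cases2; simp)+
qed

lemma re_numeral [simp]: "re (numeral k) = numeral k" and im_numeral [simp]: "im (numeral k) = 0"
  using re_of_int[of "numeral k"] im_of_int[of "numeral k"] by simp_all

definition conj :: "zsqrt2 \<Rightarrow> zsqrt2" where
  "conj z = ZSqrt2 (re z) (- im z)"

lemma conj_sel [simp]: "re (conj z) = re z" "im (conj z) = - im z"
  by (simp_all add: conj_def)

lemma conj_conj [simp]: "conj (conj z) = z"
  by (simp add: zsqrt2_eq_iff)

lemma conj_mult [simp]: "conj (z * w) = conj z * conj w"
  by (simp add: zsqrt2_eq_iff algebra_simps)

lemma conj_power [simp]: "conj (z ^ n) = conj z ^ n"
  by (induction n) (simp_all add: zsqrt2_eq_iff)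

definition norm2 :: "zsqrt2 \<Rightarrow> int" where
  "norm2 z = (re z)\<^sup>2 - 2 * (im z)\<^sup>2"

lemma norm2_mult [simp]: "norm2 (z * w) = norm2 z * norm2 w"
  by (simp add: norm2_def power2_eq_square algebra_simps)

lemma norm2_1 [simp]: "norm2 1 = 1"
  by (simp add: norm2_def)

lemma norm2_power [simp]: "norm2 (z ^ n) = norm2 z ^ n"
  by (induction n) simp_all

lemma norm2_of_int [simp]: "norm2 (of_int t) = t\<^sup>2"
  by (simp add: norm2_def)

lemma norm2_conj [simp]: "norm2 (conj z) = norm2 z"
  by (simp add: norm2_def)

lemma mult_conj: "z * conj z = of_int (norm2 z)"
  by (simp add: zsqrt2_eq_iff norm2_def power2_eq_square)

lemma Legendre_cong: "[a = b] (mod p) \<Longrightarrow> Legendre a p = Legendre b p"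
  by (simp add: Legendre_def QuadRes_def cong_def)

locale odd_prime =
  fixes p :: int
  assumes prime_p: "prime p" and p_gt_2: "2 < p"
begin

abbreviation chi :: "int \<Rightarrow> int" where "chi a \<equiv> Legendre a p"

lemma chi_eq_0_iff [simp]: "chi a = 0 \<longleftrightarrow> p dvd a"
  by (simp add: Legendre_def cong_0_iff)

lemma chi_values: "chi a \<in> {-1, 0, 1}"
  by (simp add: Legendre_def)

lemma chi_cases: "\<not> p dvd a \<Longrightarrow> chi a = 1 \<or> chi a = -1"
  by (simp add: Legendre_def cong_0_iff)

lemma euler: "[chi a = a ^ nat ((p - 1) div 2)] (mod p)"
proof -
  have "prime (nat p)" "2 < nat p"
    using prime_p p_gt_2 by auto
  moreover have "(nat p - 1) div 2 = nat ((p - 1) div 2)"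
    using p_gt_2 by (simp add: nat_div_distrib nat_diff_distrib)
  ultimately show ?thesis
    using euler_criterion[of "nat p" a] p_gt_2 by simp
qed

lemma chi_eqI:
  assumes "[u = v] (mod p)" "u \<in> {-1, 0, 1}" "v \<in> {-1, 0, 1}"
  shows "u = v"
proof -
  have "p dvd u - v" using assms(1) by (simp add: cong_iff_dvd_diff)
  moreover have "\<bar>u - v\<bar> < p" using assms(2,3) p_gt_2 by auto
  ultimately show ?thesis
    using zdvd_imp_le[of p "\<bar>u - v\<bar>"] by force
qed

lemma chi_mult [simp]: "chi (a * b) = chi a * chi b"
proof (rule chi_eqI)
  show "[chi (a * b) = chi a * chi b] (mod p)"
    using cong_mult[OF euler[of a] euler[of b]] euler[of "a * b"]
    by (metis power_mult_distrib cong_sym cong_trans)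
  show "chi a * chi b \<in> {-1, 0, 1}"
    using chi_values[of a] chi_values[of b] by auto
qed (rule chi_values)

lemma chi_1 [simp]: "chi 1 = 1"
proof -
  have "QuadRes p 1" unfolding QuadRes_def by (rule exI[of _ 1]) simp
  then show ?thesis using p_gt_2 by (simp add: Legendre_def cong_0_iff)
qed

lemma chi_0 [simp]: "chi 0 = 0"
  by simp

lemma chi_power [simp]: "chi (a ^ n) = chi a ^ n"
  by (induction n) simp_all

lemma chi_square: "\<not> p dvd a \<Longrightarrow> (chi a)\<^sup>2 = 1"
  using chi_cases[of a] by auto

lemma chi_even_power: "\<not> p dvd a \<Longrightarrow> even n \<Longrightarrow> chi a ^ n = 1"
  using chi_cases[of a] by auto

lemma chi_minus_1: "chi (-1) = (-1) ^ nat ((p - 1) div 2)"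
  by (rule chi_eqI[OF euler chi_values]) (metis insertCI neg_one_even_power neg_one_odd_power)

lemma p_dvd_mult_iff [simp]: "p dvd a * b \<longleftrightarrow> p dvd a \<or> p dvd b"
  using prime_p by (rule prime_dvd_mult_iff)

lemma p_dvd_power_iff [simp]: "n > 0 \<Longrightarrow> p dvd a ^ n \<longleftrightarrow> p dvd a"
  using prime_p by (rule prime_dvd_power_iff)

lemma p_not_dvd_small: "0 < a \<Longrightarrow> a < p \<Longrightarrow> \<not> p dvd a"
  using zdvd_not_zless by blast

lemma p_not_dvd_2 [simp]: "\<not> p dvd 2"
  using p_gt_2 by (intro p_not_dvd_small) auto

lemma p_not_dvd_1 [simp]: "\<not> p dvd 1"
  using p_gt_2 by (intro p_not_dvd_small) auto

lemma inverse_mod_p: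
  assumes "\<not> p dvd a"
  obtains b where "[a * b = 1] (mod p)"
proof -
  have "coprime a p"
    using assms prime_p prime_imp_coprime coprime_commute by blast
  then show ?thesis
    using cong_solve_coprime_int that by blast
qed

abbreviation residues :: "int set" where "residues \<equiv> {0..p-1}"

definition periodic :: "(int \<Rightarrow> 'b) \<Rightarrow> bool" where
  "periodic f \<longleftrightarrow> (\<forall>x y. [x = y] (mod p) \<longrightarrow> f x = f y)"

lemma periodicD: "periodic f \<Longrightarrow> [x = y] (mod p) \<Longrightarrow> f x = f y"
  by (simp add: periodic_def)

lemma sum_residues_reindex:
  fixes f :: "int \<Rightarrow> 'b::comm_monoid_add"
  assumes "periodic f" "\<And>x y. [x = y] (mod p) \<Longrightarrow> [h x = h y] (mod p)"
    and "\<And>y. \<exists>x. [h x = y] (mod p)"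
  shows "(\<Sum>x\<in>residues. f (h x)) = (\<Sum>x\<in>residues. f x)"
proof (rule sum_reindex_retract[where red = "\<lambda>x. x mod p"])
  show "x mod p \<in> residues" for x
    using p_gt_2 by (simp add: zle_diff1_eq)
  show "h (x mod p) mod p = h x mod p" for x
    using assms(2)[of "x mod p" x] by (simp add: cong_def)
  show "\<exists>x. h x mod p = y" if "y \<in> residues" for y
  proof -
    obtain x where "[h x = y] (mod p)" using assms(3) by blast
    then show ?thesis using that by (auto simp: cong_def)
  qed
qed (use assms(1) in \<open>auto intro: periodicD\<close>)

lemma sum_residues_linear:
  fixes f :: "int \<Rightarrow> 'b::comm_monoid_add"
  assumes "periodic f" "\<not> p dvd a"
  shows "(\<Sum>x\<in>residues. f (a * x + b)) = (\<Sum>x\<in>residues. f x)"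
proof (rule sum_residues_reindex[OF assms(1)])
  fix y
  obtain a' where a': "[a * a' = 1] (mod p)"
    using assms(2) by (rule inverse_mod_p)
  have "[a * a' * (y - b) + b = 1 * (y - b) + b] (mod p)"
    by (intro cong_add cong_mult a') auto
  then show "\<exists>x. [a * x + b = y] (mod p)"
    by (intro exI[of _ "a' * (y - b)"]) (simp add: mult.assoc)
qed (intro cong_add cong_mult; simp)

lemma periodic_chi_poly:
  assumes "\<And>x y. [x = y] (mod p) \<Longrightarrow> [g x = g y] (mod p)"
  shows "periodic (\<lambda>x. chi (g x))"
  using assms Legendre_cong unfolding periodic_def by blast

lemma sum_chi:
  assumes "chi n = -1"
  shows "(\<Sum>x\<in>residues. chi x) = 0"
proof -
  have "\<not> p dvd n" using assms by (metis chi_eq_0_iff zero_neq_neg_one)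
  then have "(\<Sum>x\<in>residues. chi (n * x + 0)) = (\<Sum>x\<in>residues. chi x)"
    by (intro sum_residues_linear periodic_chi_poly)
  moreover have "(\<Sum>x\<in>residues. chi (n * x + 0)) = - (\<Sum>x\<in>residues. chi x)"
    by (simp add: assms sum_negf)
  ultimately show ?thesis by simp
qed

lemma sum_residues_if_dvd:
  fixes a b :: int
  shows "(\<Sum>x\<in>residues. if p dvd x then a else b) = a + (p - 1) * b"
proof -
  have "(\<Sum>x\<in>residues. if p dvd x then a else b) =
      (\<Sum>x\<in>residues. (if x = 0 then a else 0) + (if x \<in> {1..p-1} then b else 0))"
    by (rule sum.cong) (auto simp: p_not_dvd_small not_le int_one_le_iff_zero_less dest: zdvd_not_zless)
  also have "\<dots> = a + (\<Sum>x\<in>residues. if x \<in> {1..p-1} then b else 0)"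
    using p_gt_2 by (simp only: sum.distrib) (simp add: sum.delta)
  also have "(\<Sum>x\<in>residues. if x \<in> {1..p-1} then b else 0) = (\<Sum>x\<in>residues \<inter> {1..p-1}. b)"
    by (rule sum.inter_restrict[symmetric]) simp
  also have "residues \<inter> {1..p-1} = {1..p-1}" by auto
  finally show ?thesis using p_gt_2 by simp
qed

lemma sum_residues_delta:
  "(\<Sum>x\<in>residues. if [x = a] (mod p) then 1 else 0) = (1::int)"
proof -
  have "(\<Sum>x\<in>residues. if [x = a] (mod p) then 1 else 0) =
      (\<Sum>x\<in>residues. if x = a mod p then 1 else (0::int))"
    by (rule sum.cong) (auto simp: cong_def)
  also have "\<dots> = 1"
    using p_gt_2 by (simp add: sum.delta zle_diff1_eq)
  finally show ?thesis .
qed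

definition zcong :: "zsqrt2 \<Rightarrow> zsqrt2 \<Rightarrow> bool"  (infix "\<approx>" 50) where
  "z \<approx> w \<longleftrightarrow> [re z = re w] (mod p) \<and> [im z = im w] (mod p)"

lemma zcong_refl [simp]: "z \<approx> z"
  by (simp add: zcong_def)

lemma zcong_trans [trans]: "z \<approx> w \<Longrightarrow> w \<approx> v \<Longrightarrow> z \<approx> v"
  unfolding zcong_def using cong_trans by blast

lemma zcong_mult: "z \<approx> z' \<Longrightarrow> w \<approx> w' \<Longrightarrow> z * w \<approx> z' * w'"
  by (auto simp: zcong_def intro!: cong_add cong_mult)

lemma zcong_power: "z \<approx> w \<Longrightarrow> z ^ n \<approx> w ^ n"
  by (induction n) (auto intro: zcong_mult)

lemma zcong_conj: "z \<approx> w \<Longrightarrow> conj z \<approx> conj w"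
  by (simp add: zcong_def cong_minus_minus_iff)

lemma norm2_zcong: "z \<approx> w \<Longrightarrow> [norm2 z = norm2 w] (mod p)"
  unfolding norm2_def zcong_def by (intro cong_diff cong_mult cong_pow) auto

lemma re_zcong: "z \<approx> w \<Longrightarrow> [re z = re w] (mod p)"
  by (simp add: zcong_def)

lemma zcong_of_int: "[s = t] (mod p) \<Longrightarrow> of_int s \<approx> of_int t"
  by (simp add: zcong_def)

definition zred :: "zsqrt2 \<Rightarrow> zsqrt2" where
  "zred z = ZSqrt2 (re z mod p) (im z mod p)"

lemma zred_eq_iff: "zred z = zred w \<longleftrightarrow> z \<approx> w"
  by (simp add: zred_def zcong_def cong_def)

lemma zred_zcong: "zred z \<approx> z"
  by (simp add: zred_def zcong_def)

definition zresidues :: "zsqrt2 set" where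
  "zresidues = (\<lambda>(x, y). ZSqrt2 x y) ` (residues \<times> residues)"

lemma finite_zresidues [simp]: "finite zresidues"
  by (simp add: zresidues_def)

lemma zred_in [simp]: "zred z \<in> zresidues"
  using p_gt_2 by (auto simp: zresidues_def zred_def zle_diff1_eq
      intro!: image_eqI[where x = "(re z mod p, im z mod p)"])

lemma zred_id: "z \<in> zresidues \<Longrightarrow> zred z = z"
  by (auto simp: zresidues_def zred_def)

lemma sum_zresidues: "(\<Sum>z\<in>zresidues. f z) = (\<Sum>x\<in>residues. \<Sum>y\<in>residues. f (ZSqrt2 x y))"
proof -
  have "inj_on (\<lambda>(x, y). ZSqrt2 x y) (residues \<times> residues)"
    by (auto simp: inj_on_def)
  then show ?thesis
    unfolding zresidues_def by (simp add: sum.reindex sum.cartesian_product case_prod_unfold o_def)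
qed

definition zperiodic :: "(zsqrt2 \<Rightarrow> 'b) \<Rightarrow> bool" where
  "zperiodic f \<longleftrightarrow> (\<forall>z w. z \<approx> w \<longrightarrow> f z = f w)"

lemma zperiodicD: "zperiodic f \<Longrightarrow> z \<approx> w \<Longrightarrow> f z = f w"
  by (simp add: zperiodic_def)

lemma sum_zresidues_reindex:
  fixes f :: "zsqrt2 \<Rightarrow> 'b::comm_monoid_add"
  assumes "zperiodic f" "\<And>z w. z \<approx> w \<Longrightarrow> h z \<approx> h w"
    and "\<And>w. \<exists>z. h z \<approx> w"
  shows "(\<Sum>z\<in>zresidues. f (h z)) = (\<Sum>z\<in>zresidues. f z)"
proof (rule sum_reindex_retract[where red = zred])
  show "zred (h (zred z)) = zred (h z)" for z
    using assms(2) by (simp add: zred_eq_iff zred_zcong)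
  show "\<exists>z. zred (h z) = w" if "w \<in> zresidues" for w
    using assms(3)[of w] that by (metis zred_eq_iff zred_id)
  show "f (zred z) = f z" for z
    using assms(1) zred_zcong by (rule zperiodicD)
qed (simp_all add: zred_id)

definition unit :: "zsqrt2 \<Rightarrow> bool" where
  "unit z \<longleftrightarrow> \<not> p dvd norm2 z"

lemma unit_mult [simp]: "unit (z * w) \<longleftrightarrow> unit z \<and> unit w"
  by (simp add: unit_def)

lemma unit_zcong: "z \<approx> w \<Longrightarrow> unit z \<longleftrightarrow> unit w"
  unfolding unit_def using norm2_zcong cong_dvd_iff by (metis cong_0_iff cong_sym cong_trans)

lemma unit_inverse:
  assumes "unit w"
  obtains v where "w * v \<approx> 1"
proof -
  obtain b where b: "[norm2 w * b = 1] (mod p)"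
    using assms inverse_mod_p unfolding unit_def by blast
  have "w * (conj w * of_int b) = of_int (norm2 w * b)"
    by (simp add: mult_conj mult.assoc[symmetric])
  moreover have "\<dots> \<approx> of_int 1"
    using b by (rule zcong_of_int)
  ultimately show ?thesis
    using that by (metis of_int_1)
qed

lemma sum_zresidues_mult:
  fixes f :: "zsqrt2 \<Rightarrow> 'b::comm_monoid_add"
  assumes "zperiodic f" "unit w"
  shows "(\<Sum>z\<in>zresidues. f (w * z)) = (\<Sum>z\<in>zresidues. f z)"
proof (rule sum_zresidues_reindex[OF assms(1)])
  fix y
  obtain v where "w * v \<approx> 1"
    using assms(2) by (rule unit_inverse)
  then have "w * v * y \<approx> 1 * y"
    by (intro zcong_mult) auto
  then show "\<exists>z. w * z \<approx> y"
    by (intro exI[of _ "v * y"]) (simp add: mult.assoc)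
qed (intro zcong_mult zcong_refl)

definition W :: "zsqrt2 \<Rightarrow> int" where
  "W c = (\<Sum>z\<in>zresidues. chi (norm2 z * re (c * z ^ 4)))"

lemma zperiodic_chi_norm2: "zperiodic (\<lambda>z. chi (norm2 z))"
  unfolding zperiodic_def using Legendre_cong norm2_zcong by blast

lemma zperiodic_chi_re: "zperiodic (\<lambda>z. chi (re (c * z ^ n)))"
  unfolding zperiodic_def
  by (blast intro: Legendre_cong re_zcong zcong_mult zcong_power zcong_refl)

lemma zperiodic_mult:
  fixes f g :: "zsqrt2 \<Rightarrow> 'b::times"
  shows "zperiodic f \<Longrightarrow> zperiodic g \<Longrightarrow> zperiodic (\<lambda>z. f z * g z)"
  unfolding zperiodic_def by metis

lemma zperiodic_W_term: "zperiodic (\<lambda>z. chi (norm2 z * re (c * z ^ 4)))"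
  by (simp only: chi_mult zperiodic_mult zperiodic_chi_norm2 zperiodic_chi_re)

lemma zperiodic_W: "zperiodic W"
  unfolding zperiodic_def W_def
  by (intro allI impI sum.cong refl Legendre_cong cong_mult cong_refl re_zcong zcong_mult zcong_refl)

lemma W_cong: "c \<approx> d \<Longrightarrow> W c = W d"
  using zperiodic_W by (rule zperiodicD)

lemma W_of_int_mult [simp]: "W (of_int t * c) = chi t * W c"
  unfolding W_def by (simp add: sum_distrib_left mult_ac flip: chi_mult)
    (simp add: algebra_simps flip: chi_mult)

lemma W_mult_pow4:
  assumes "unit w"
  shows "W (c * w ^ 4) = chi (norm2 w) * W c"
proof -
  have "chi (norm2 w) * chi (norm2 w) = 1"
    using assms chi_square by (simp add: unit_def power2_eq_square)
  then have "W (c * w ^ 4) = chi (norm2 w) * (chi (norm2 w) * W (c * w ^ 4))"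
    by (simp flip: mult.assoc)
  also have "chi (norm2 w) * W (c * w ^ 4) =
      (\<Sum>z\<in>zresidues. chi (norm2 (w * z) * re (c * (w * z) ^ 4)))"
    unfolding W_def sum_distrib_left
    by (intro sum.cong refl) (simp only: chi_mult norm2_mult power_mult_distrib mult.assoc)
  also have "\<dots> = W c"
    unfolding W_def using sum_zresidues_mult[OF zperiodic_W_term assms] .
  finally show ?thesis .
qed

lemma W_conj: "W (conj c) = W c"
proof -
  have "W (conj c) = (\<Sum>z\<in>zresidues. chi (norm2 (conj z) * re (c * (conj z) ^ 4)))"
    unfolding W_def
  proof (intro sum.cong refl)
    fix z
    have "re (conj c * z ^ 4) = re (c * conj z ^ 4)"
      by (metis conj_sel(1) conj_mult conj_power conj_conj)
    then show "chi (norm2 z * re (conj c * z ^ 4)) = chi (norm2 (conj z) * re (c * conj z ^ 4))"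
      by simp
  qed
  also have "\<dots> = W c"
    unfolding W_def
  proof (rule sum_zresidues_reindex[OF zperiodic_W_term zcong_conj])
    show "\<exists>z. conj z \<approx> w" for w
      by (rule exI[of _ "conj w"]) simp
  qed
  finally show ?thesis .
qed

text \<open>Conjugation fixes the value of W at e^2 but multiplies e^2 by conj e^4 / N(e)^2.\<close>

lemma W_square_of_nonresidue:
  assumes "chi (norm2 e) = -1"
  shows "W (e\<^sup>2) = 0"
proof -
  have u: "unit (conj e)" "unit e"
    using assms by (auto simp: unit_def simp flip: chi_eq_0_iff)
  have "W (e\<^sup>2 * conj e ^ 4) = - W (e\<^sup>2)"
    using W_mult_pow4[OF u(1), of "e\<^sup>2"] assms by simp
  moreover have "e\<^sup>2 * conj e ^ 4 = of_int ((norm2 e)\<^sup>2) * conj (e\<^sup>2)"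
  proof -
    have "e\<^sup>2 * conj e ^ 4 = (e * conj e)\<^sup>2 * (conj e)\<^sup>2"
      by (simp add: power_mult_distrib mult.assoc flip: power_add)
    then show ?thesis by (simp add: mult_conj)
  qed
  ultimately show ?thesis
    by (simp add: assms W_conj del: conj_power of_int_power)
qed

text \<open>Hilbert 90: if N(c) = l^2, then c / l has norm 1, hence equals e / conj e with e = l + c.\<close>

lemma residue_norm_imp_square:
  assumes "chi (norm2 c) = 1"
  obtains t e where "\<not> p dvd t" "of_int t * c \<approx> e\<^sup>2" "unit e"
proof -
  have nd: "\<not> p dvd norm2 c"
    using assms by (simp flip: chi_eq_0_iff)
  have "QuadRes p (norm2 c)"
    using assms by (auto simp: Legendre_def split: if_splits)
  then obtain m where m: "[m\<^sup>2 = norm2 c] (mod p)"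
    by (auto simp: QuadRes_def)
  have dm: "\<not> p dvd m"
    using m nd by (metis cong_dvd_iff cong_sym cong_0_iff cong_trans p_dvd_power_iff zero_less_numeral)
  obtain l where l: "[l\<^sup>2 = norm2 c] (mod p)" "\<not> p dvd l + re c"
  proof (cases "p dvd m + re c")
    case True
    have "\<not> p dvd - m + re c"
    proof
      assume "p dvd - m + re c"
      with True have "p dvd (m + re c) - (- m + re c)" by (rule dvd_diff)
      then have "p dvd 2 * m" by simp
      with dm show False using p_dvd_mult_iff p_not_dvd_2 by blast
    qed
    with m show ?thesis by (intro that[of "- m"]) auto
  qed (use m that in blast)
  let ?e = "of_int l + c" and ?t = "2 * (l + re c)"
  have t: "\<not> p dvd ?t" using l(2) by (simp only: p_dvd_mult_iff p_not_dvd_2) simp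
  have d: "p dvd l\<^sup>2 - norm2 c" using l(1) by (simp add: cong_iff_dvd_diff)
  have e: "of_int ?t * c \<approx> ?e\<^sup>2"
  proof -
    have "re (?e\<^sup>2) - re (of_int ?t * c) = l\<^sup>2 - norm2 c" "im (?e\<^sup>2) - im (of_int ?t * c) = 0"
      by (simp_all add: power2_eq_square norm2_def algebra_simps)
    then show ?thesis
      using d by (metis zcong_def cong_iff_dvd_diff cong_sym dvd_0_right)
  qed
  have "unit (of_int ?t * c)"
    using t nd by (simp only: unit_def norm2_mult norm2_of_int p_dvd_mult_iff p_dvd_power_iff zero_less_numeral
        simp_thms)
  then have "unit (?e\<^sup>2)" using unit_zcong[OF e] by simp
  then have "unit ?e" by (simp add: power2_eq_square)
  with t e show ?thesis by (rule that)
qed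

definition V :: "zsqrt2 \<Rightarrow> int" where "V c = (W c)\<^sup>2"

lemma V_cong: "c \<approx> d \<Longrightarrow> V c = V d"
  unfolding V_def using W_cong by metis

lemma V_of_int_mult: "\<not> p dvd t \<Longrightarrow> V (of_int t * c) = V c"
  by (simp add: V_def power_mult_distrib chi_square)

lemma V_mult_pow4: "unit w \<Longrightarrow> V (c * w ^ 4) = V c"
  by (simp add: V_def W_mult_pow4 power_mult_distrib chi_square unit_def)

lemma V_square:
  assumes "unit e"
  shows "V (e\<^sup>2) = (if chi (norm2 e) = 1 then V 1 else 0)"
proof (cases "chi (norm2 e) = 1")
  case True
  then obtain s f where s: "\<not> p dvd s" "of_int s * e \<approx> f\<^sup>2" "unit f"
    by (rule residue_norm_imp_square)
  have "V (e\<^sup>2) = V (of_int (s\<^sup>2) * e\<^sup>2)"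
    using s(1) by (intro V_of_int_mult[symmetric]) simp
  also have "\<dots> = V ((of_int s * e)\<^sup>2)"
    by (simp add: power_mult_distrib)
  also have "\<dots> = V ((f\<^sup>2)\<^sup>2)"
    using zcong_power[OF s(2)] by (rule V_cong)
  also have "\<dots> = V (1 * f ^ 4)"
    by (simp flip: power_mult)
  also have "\<dots> = V 1"
    using s(3) by (rule V_mult_pow4)
  finally show ?thesis using True by simp
next
  case False
  then have "chi (norm2 e) = -1"
    using assms chi_cases by (auto simp: unit_def)
  then show ?thesis
    by (simp add: V_def W_square_of_nonresidue)
qed

lemma V_residue:
  assumes "chi (norm2 c) = 1" "chi (norm2 c0) = -1"
  shows "V c + V (c * c0\<^sup>2) = V 1"
proof -
  obtain t e where t: "\<not> p dvd t" "of_int t * c \<approx> e\<^sup>2" "unit e"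
    using assms(1) by (rule residue_norm_imp_square)
  have u0: "unit c0" using assms(2) by (auto simp: unit_def simp flip: chi_eq_0_iff)
  have "V c = V (e\<^sup>2)"
    using V_of_int_mult[OF t(1), of c] V_cong[OF t(2)] by simp
  moreover have "V (c * c0\<^sup>2) = V ((e * c0)\<^sup>2)"
  proof -
    have "of_int t * c * c0\<^sup>2 \<approx> e\<^sup>2 * c0\<^sup>2"
      by (intro zcong_mult t zcong_refl)
    then show ?thesis
      using V_of_int_mult[OF t(1), of "c * c0\<^sup>2"] V_cong by (simp add: power_mult_distrib mult.assoc)
  qed
  moreover have "chi (norm2 e) = 1 \<or> chi (norm2 e) = -1"
    using t(3) chi_cases by (simp add: unit_def)
  ultimately show ?thesis
    using t(3) u0 assms(2) by (auto simp: V_square)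
qed

lemma V_nonresidue:
  assumes "chi (norm2 c) = -1" "chi (norm2 c0) = -1"
  shows "V c = V c0"
proof -
  have u0: "unit c0" using assms(2) by (auto simp: unit_def simp flip: chi_eq_0_iff)
  have "chi (norm2 (c * c0)) = 1" using assms by simp
  then obtain t e where t: "\<not> p dvd t" "of_int t * (c * c0) \<approx> e\<^sup>2" "unit e"
    by (rule residue_norm_imp_square)
  show ?thesis
  proof (cases "chi (norm2 e) = 1")
    case True
    then obtain s f where s: "\<not> p dvd s" "of_int s * e \<approx> f\<^sup>2" "unit f"
      by (rule residue_norm_imp_square)
    have "of_int (s\<^sup>2 * t * norm2 c0) * c = of_int (s\<^sup>2) * (of_int t * (c * c0)) * conj c0"
      by (simp add: mult_ac flip: mult_conj)
    also have "\<dots> \<approx> of_int (s\<^sup>2) * e\<^sup>2 * conj c0"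
      by (intro zcong_mult t zcong_refl)
    also have "of_int (s\<^sup>2) * e\<^sup>2 * conj c0 = (of_int s * e)\<^sup>2 * conj c0"
      by (simp add: power_mult_distrib)
    also have "\<dots> \<approx> (f\<^sup>2)\<^sup>2 * conj c0"
      by (intro zcong_mult zcong_power s zcong_refl)
    also have "(f\<^sup>2)\<^sup>2 * conj c0 = conj c0 * f ^ 4"
      by (simp add: mult.commute flip: power_mult)
    finally have "V (of_int (s\<^sup>2 * t * norm2 c0) * c) = V (conj c0 * f ^ 4)"
      by (rule V_cong)
    moreover have nd: "\<not> p dvd s\<^sup>2 * t * norm2 c0"
      using s(1) t(1) u0 by (simp add: unit_def)
    ultimately have "V c = V (conj c0)"
      by (simp only: V_of_int_mult[OF nd] V_mult_pow4[OF s(3)])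
    then show ?thesis by (simp add: V_def W_conj)
  next
    case False
    then have "chi (norm2 (e * c0)) = 1"
      using t(3) chi_cases assms(2) by (auto simp: unit_def)
    then obtain s f where s: "\<not> p dvd s" "of_int s * (e * c0) \<approx> f\<^sup>2" "unit f"
      by (rule residue_norm_imp_square)
    have "of_int (s\<^sup>2 * t) * (c * c0 ^ 4) = of_int (s\<^sup>2) * c0 ^ 3 * (of_int t * (c * c0))"
      by (simp add: power4_eq_xxxx power3_eq_cube mult_ac)
    also have "\<dots> \<approx> of_int (s\<^sup>2) * c0 ^ 3 * e\<^sup>2"
      by (intro zcong_mult t zcong_refl)
    also have "of_int (s\<^sup>2) * c0 ^ 3 * e\<^sup>2 = (of_int s * (e * c0))\<^sup>2 * c0"
      by (simp add: power_mult_distrib power3_eq_cube power2_eq_square mult_ac)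
    also have "\<dots> \<approx> (f\<^sup>2)\<^sup>2 * c0"
      by (intro zcong_mult zcong_power s zcong_refl)
    also have "(f\<^sup>2)\<^sup>2 * c0 = c0 * f ^ 4"
      by (simp add: mult.commute flip: power_mult)
    finally have "V (of_int (s\<^sup>2 * t) * (c * c0 ^ 4)) = V (c0 * f ^ 4)"
      by (rule V_cong)
    moreover have nd: "\<not> p dvd s\<^sup>2 * t"
      using s(1) t(1) by simp
    ultimately show ?thesis
      by (simp only: V_of_int_mult[OF nd] V_mult_pow4[OF s(3)] V_mult_pow4[OF u0])
  qed
qed

lemma V_orbit:
  assumes "unit c" "chi (norm2 c0) = -1"
  shows "V c + V (c * c0) + V (c * c0\<^sup>2) + V (c * c0 ^ 3) = V 1 + 2 * V c0"
proof (cases "chi (norm2 c) = 1")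
  case True
  then show ?thesis
    using V_residue[OF True assms(2)] V_nonresidue[of "c * c0" c0] V_nonresidue[of "c * c0 ^ 3" c0] assms
    by simp
next
  case False
  then have n: "chi (norm2 c) = -1"
    using assms chi_cases by (auto simp: unit_def)
  have "c * c0 * c0\<^sup>2 = c * c0 ^ 3"
    by (simp add: power3_eq_cube power2_eq_square mult_ac)
  then show ?thesis
    using V_residue[of "c * c0" c0] V_nonresidue[of c c0] V_nonresidue[of "c * c0\<^sup>2" c0] n assms
    by simp
qed

lemma W_nonunit:
  assumes "\<not> unit c" "chi (norm2 c0) = -1"
  shows "W c = 0"
proof -
  let ?s = "2 * re c" and ?l = "2 * re (c * c0)"
  have u0: "unit c0" using assms(2) by (auto simp: unit_def simp flip: chi_eq_0_iff)
  have N: "p dvd norm2 c" using assms(1) by (simp add: unit_def)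
  show ?thesis
  proof (cases "p dvd re c")
    case True
    then have "p dvd (re c)\<^sup>2 - norm2 c"
      using N by (intro dvd_diff) simp_all
    then have "p dvd 2 * (im c)\<^sup>2" by (simp add: norm2_def)
    then have "p dvd im c"
      using p_dvd_mult_iff p_not_dvd_2 p_dvd_power_iff zero_less_numeral by blast
    with True have "c \<approx> of_int 0 * 1" by (simp add: zcong_def cong_0_iff)
    then show ?thesis by (metis W_cong W_of_int_mult chi_0 mult_zero_left)
  next
    case False
    have step: "(of_int ?s * c0) * c \<approx> of_int ?l * c"
    proof -
      have "re ((of_int ?s * c0) * c) - re (of_int ?l * c) = 0"
        "im ((of_int ?s * c0) * c) - im (of_int ?l * c) = 2 * im c0 * norm2 c"
        by (simp_all add: norm2_def power2_eq_square algebra_simps)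
      then show ?thesis
        using N by (simp add: zcong_def cong_iff_dvd_diff)
    qed
    have iter: "(of_int ?s * c0) ^ n * c \<approx> of_int ?l ^ n * c" for n
    proof (induction n)
      case (Suc n)
      have "(of_int ?s * c0) ^ Suc n * c = (of_int ?s * c0) ^ n * ((of_int ?s * c0) * c)"
        by (simp only: power_Suc mult_ac)
      also have "\<dots> \<approx> (of_int ?s * c0) ^ n * (of_int ?l * c)"
        by (intro zcong_mult step zcong_refl)
      also have "\<dots> = of_int ?l * ((of_int ?s * c0) ^ n * c)"
        by (simp only: mult_ac)
      also have "\<dots> \<approx> of_int ?l * (of_int ?l ^ n * c)"
        by (intro zcong_mult Suc zcong_refl)
      also have "\<dots> = of_int ?l ^ Suc n * c"
        by (simp only: power_Suc mult_ac)
      finally show ?case .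
    qed simp
    have "of_int (?s ^ 4) * (c * c0 ^ 4) = (of_int ?s * c0) ^ 4 * c"
      by (simp only: of_int_power) (simp only: power_mult_distrib mult_ac)
    also have "\<dots> \<approx> of_int ?l ^ 4 * c"
      by (rule iter)
    also have "of_int ?l ^ 4 * c = of_int (?l ^ 4) * c"
      by (simp only: of_int_power)
    finally have "W (of_int (?s ^ 4) * (c * c0 ^ 4)) = W (of_int (?l ^ 4) * c)"
      by (rule W_cong)
    then have "chi (?s ^ 4) * - W c = chi (?l ^ 4) * W c"
      by (simp only: W_of_int_mult W_mult_pow4[OF u0] assms(2) mult_minus1)
    moreover have "chi (?s ^ 4) = 1"
      using False p_not_dvd_2 p_dvd_mult_iff by (subst chi_power, intro chi_even_power) (blast, simp)
    moreover have "chi (?l ^ 4) \<in> {0, 1}"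
      using chi_values[of ?l] by (auto simp only: chi_power insert_iff empty_iff) auto
    ultimately have "- W c = 0 * W c \<or> - W c = 1 * W c"
      by (metis insertE singletonD mult_1)
    then show ?thesis by auto
  qed
qed

definition K :: "zsqrt2 \<Rightarrow> int" where
  "K v = (\<Sum>c\<in>zresidues. chi (re (c * v)) * chi (re c))"

lemma K_eq:
  assumes "chi n = -1"
  shows "K v = (if p dvd im v then chi (re v) * (p * (p - 1)) else 0)"
proof (cases "p dvd im v")
  case True
  have "K v = (\<Sum>a\<in>residues. \<Sum>b\<in>residues. chi (re v) * (if p dvd a then 0 else 1))"
    unfolding K_def sum_zresidues
  proof (intro sum.cong refl)
    fix a b
    have "[a * re v + 2 * b * im v = a * re v] (mod p)"
      using True by (simp add: cong_iff_dvd_diff)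
    then have "chi (re (ZSqrt2 a b * v)) = chi a * chi (re v)"
      using Legendre_cong by fastforce
    then show "chi (re (ZSqrt2 a b * v)) * chi (re (ZSqrt2 a b)) = chi (re v) * (if p dvd a then 0 else 1)"
      using chi_square[of a] by (simp add: power2_eq_square mult_ac)
  qed
  also have "\<dots> = chi (re v) * (p * (p - 1))"
    using p_gt_2 by (simp add: sum_residues_if_dvd flip: sum_distrib_left)
  finally show ?thesis using True by simp
next
  case False
  have "K v = (\<Sum>a\<in>residues. (\<Sum>b\<in>residues. chi (2 * im v * b + a * re v)) * chi a)"
    unfolding K_def sum_zresidues sum_distrib_right by (intro sum.cong refl) (simp add: algebra_simps)
  also have "\<dots> = (\<Sum>a\<in>residues. (\<Sum>b\<in>residues. chi b) * chi a)"
  proof -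
    have "\<not> p dvd 2 * im v" using False p_not_dvd_2 p_dvd_mult_iff by blast
    then have "(\<Sum>b\<in>residues. chi (2 * im v * b + k)) = (\<Sum>b\<in>residues. chi b)" for k
      by (intro sum_residues_linear periodic_chi_poly)
    then show ?thesis by simp
  qed
  finally show ?thesis using False sum_chi[OF assms] by simp
qed

lemma zperiodic_K_term: "zperiodic (\<lambda>c. chi (re (c * v)) * chi (re c))"
  unfolding zperiodic_def
  by (metis Legendre_cong re_zcong zcong_mult zcong_refl)

lemma sum_V:
  "(\<Sum>c\<in>zresidues. V c) =
    int (card {w \<in> zresidues. unit w}) * (\<Sum>u\<in>zresidues. chi (norm2 u) * K (u ^ 4))"
proof -
  define g where "g = (\<lambda>c z. chi (norm2 z * re (c * z ^ 4)))"
  have per: "zperiodic (g c)" for c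
    unfolding g_def by (rule zperiodic_W_term)
  let ?M = "\<Sum>u\<in>zresidues. chi (norm2 u) * K (u ^ 4)"
  have "(\<Sum>c\<in>zresidues. V c) = (\<Sum>c\<in>zresidues. \<Sum>w\<in>zresidues. (\<Sum>z\<in>zresidues. g c z) * g c w)"
    unfolding V_def W_def g_def by (simp only: power2_eq_square sum_distrib_left)
  also have "\<dots> = (\<Sum>w\<in>zresidues. \<Sum>c\<in>zresidues. (\<Sum>z\<in>zresidues. g c z) * g c w)"
    by (rule sum.swap)
  also have "\<dots> = (\<Sum>w\<in>zresidues. if unit w then ?M else 0)"
  proof (intro sum.cong refl)
    fix w
    show "(\<Sum>c\<in>zresidues. (\<Sum>z\<in>zresidues. g c z) * g c w) = (if unit w then ?M else 0)"
    proof (cases "unit w")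
      case False
      then have "g c w = 0" for c by (simp add: g_def unit_def)
      with False show ?thesis by simp
    next
      case True
      have sq: "chi (norm2 w) * chi (norm2 w) = 1"
        using True chi_square by (simp add: unit_def power2_eq_square)
      have "(\<Sum>c\<in>zresidues. (\<Sum>z\<in>zresidues. g c z) * g c w) =
          (\<Sum>c\<in>zresidues. \<Sum>u\<in>zresidues. g c (w * u) * g c w)"
        by (simp add: sum_zresidues_mult[OF per True] flip: sum_distrib_right)
      also have "\<dots> = (\<Sum>u\<in>zresidues. \<Sum>c\<in>zresidues. g c (w * u) * g c w)"
        by (rule sum.swap)
      also have "\<dots> = ?M"
      proof (intro sum.cong refl)
        fix u
        let ?k = "\<lambda>c. chi (re (c * u ^ 4)) * chi (re c)"
        have "g c (w * u) * g c w = chi (norm2 u) * ?k (w ^ 4 * c)" for c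
        proof -
          have "g c (w * u) * g c w =
              (chi (norm2 w) * chi (norm2 w)) * (chi (norm2 u) * ?k (w ^ 4 * c))"
            unfolding g_def by (simp only: chi_mult norm2_mult power_mult_distrib mult_ac)
          then show ?thesis using sq by simp
        qed
        then have "(\<Sum>c\<in>zresidues. g c (w * u) * g c w) =
            chi (norm2 u) * (\<Sum>c\<in>zresidues. ?k (w ^ 4 * c))"
          by (simp add: sum_distrib_left)
        also have "(\<Sum>c\<in>zresidues. ?k (w ^ 4 * c)) = K (u ^ 4)"
          unfolding K_def
          by (rule sum_zresidues_mult[OF zperiodic_K_term]) (use True in \<open>simp add: unit_def\<close>)
        finally show "(\<Sum>c\<in>zresidues. g c (w * u) * g c w) = chi (norm2 u) * K (u ^ 4)" .
      qed
      finally show ?thesis using True by simp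
    qed
  qed
  also have "\<dots> = int (card {w \<in> zresidues. unit w}) * ?M"
    by (simp flip: sum.inter_filter)
  finally show ?thesis .
qed

text \<open>The nonzero u with u^4 in Z/p form the lines x = 0, y = 0 and x = d y, x = - d y, where d^2 = -2.\<close>

lemma sum_chi_real_fourth_powers:
  assumes "chi (-2) = 1"
  shows "(\<Sum>u\<in>zresidues. if p dvd im (u ^ 4) then chi (norm2 u * re (u ^ 4)) else 0) = 4 * (p - 1)"
proof -
  have "QuadRes p (-2)" using assms by (auto simp: Legendre_def split: if_splits)
  then obtain d where "[d\<^sup>2 = -2] (mod p)" by (auto simp: QuadRes_def)
  then have d: "p dvd d\<^sup>2 + 2" by (simp add: cong_iff_dvd_diff)
  have nd: "\<not> p dvd d"
  proof
    assume "p dvd d"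
    then have "p dvd (d\<^sup>2 + 2) - d\<^sup>2" using d by (intro dvd_diff) simp_all
    then show False by simp
  qed
  have re4: "re (ZSqrt2 x y ^ 4) = x ^ 4 + 12 * x\<^sup>2 * y\<^sup>2 + 4 * y ^ 4"
    and im4: "im (ZSqrt2 x y ^ 4) = (2 * 2) * (x * y * (x\<^sup>2 + 2 * y\<^sup>2))" for x y
    by (simp_all add: power4_eq_xxxx power2_eq_square algebra_simps)
  have dvd_im4: "p dvd im (ZSqrt2 x y ^ 4) \<longleftrightarrow> p dvd x \<or> p dvd y \<or> p dvd x\<^sup>2 + 2 * y\<^sup>2" for x y
    by (simp only: im4 p_dvd_mult_iff p_not_dvd_2) blast
  define h where "h x y = (if p dvd im (ZSqrt2 x y ^ 4)
      then chi (norm2 (ZSqrt2 x y) * re (ZSqrt2 x y ^ 4)) else 0)" for x y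
  have y0: "h x y = (if p dvd x then 0 else 1)" if "p dvd y" for x y
  proof -
    have "[(x\<^sup>2 - 2 * y\<^sup>2) * (x ^ 4 + 12 * x\<^sup>2 * y\<^sup>2 + 4 * y ^ 4) = x ^ 6] (mod p)"
    proof -
      have "(x\<^sup>2 - 2 * y\<^sup>2) * (x ^ 4 + 12 * x\<^sup>2 * y\<^sup>2 + 4 * y ^ 4) - x ^ 6 =
          y * (y * (10 * x ^ 4 - 20 * x\<^sup>2 * y\<^sup>2 - 8 * y ^ 4))"
        by (simp add: eval_nat_numeral algebra_simps)
      then show ?thesis using that by (simp add: cong_iff_dvd_diff)
    qed
    then have "h x y = chi (x ^ 6)"
      using Legendre_cong that unfolding h_def re4 norm2_def dvd_im4 by force
    then show ?thesis using chi_even_power[of x 6] by auto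
  qed
  have y1: "h x y = (if [x = 0] (mod p) then 1 else 0) + (if [x = d * y] (mod p) then 1 else 0)
      + (if [x = - (d * y)] (mod p) then 1 else 0)" if y: "\<not> p dvd y" for x y
  proof -
    have x0: "chi (norm2 (ZSqrt2 x y) * re (ZSqrt2 x y ^ 4)) = 1" if "p dvd x"
    proof -
      have "norm2 (ZSqrt2 x y) * re (ZSqrt2 x y ^ 4) - (-2) * (2 * y ^ 3)\<^sup>2 =
          x * (x * (x ^ 4 + 10 * x\<^sup>2 * y\<^sup>2 - 20 * y ^ 4))"
        unfolding re4 norm2_def by (simp add: eval_nat_numeral algebra_simps)
      then have "chi (norm2 (ZSqrt2 x y) * re (ZSqrt2 x y ^ 4)) = chi ((-2) * (2 * y ^ 3)\<^sup>2)"
        using that by (intro Legendre_cong) (simp add: cong_iff_dvd_diff)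
      also have "\<dots> = 1"
        unfolding chi_mult chi_power assms using y
        by (simp add: power_mult_distrib chi_even_power flip: power_mult)
      finally show ?thesis .
    qed
    have x1: "chi (norm2 (ZSqrt2 x y) * re (ZSqrt2 x y ^ 4)) = 1" if "p dvd x\<^sup>2 + 2 * y\<^sup>2"
    proof -
      have "norm2 (ZSqrt2 x y) * re (ZSqrt2 x y ^ 4) - (2 ^ 3 * y ^ 3)\<^sup>2 =
          (x\<^sup>2 + 2 * y\<^sup>2) * (x ^ 4 + 8 * x\<^sup>2 * y\<^sup>2 - 36 * y ^ 4)"
        unfolding re4 norm2_def by (simp add: eval_nat_numeral algebra_simps)
      then have "chi (norm2 (ZSqrt2 x y) * re (ZSqrt2 x y ^ 4)) = chi ((2 ^ 3 * y ^ 3)\<^sup>2)"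
        using that by (intro Legendre_cong) (simp add: cong_iff_dvd_diff)
      also have "\<dots> = 1"
        unfolding chi_mult chi_power using y
        by (simp add: power_mult_distrib chi_even_power flip: power_mult)
      finally show ?thesis .
    qed
    have "x\<^sup>2 + 2 * y\<^sup>2 = (x - d * y) * (x + d * y) + (d\<^sup>2 + 2) * y\<^sup>2"
      by (simp add: power2_eq_square algebra_simps)
    then have fac: "p dvd x\<^sup>2 + 2 * y\<^sup>2 \<longleftrightarrow> p dvd x - d * y \<or> p dvd x + d * y"
      using d by (simp add: dvd_add_left_iff)
    have dy: "\<not> p dvd d * y" using nd y by simp
    have excl: "\<not> (p dvd x \<and> p dvd x - d * y)" "\<not> (p dvd x \<and> p dvd x + d * y)"
      "\<not> (p dvd x - d * y \<and> p dvd x + d * y)"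
    proof -
      show "\<not> (p dvd x \<and> p dvd x - d * y)" "\<not> (p dvd x \<and> p dvd x + d * y)"
        using dy by (metis dvd_diff_right_iff, metis dvd_add_right_iff)
      show "\<not> (p dvd x - d * y \<and> p dvd x + d * y)"
      proof
        assume "p dvd x - d * y \<and> p dvd x + d * y"
        then have "p dvd (x + d * y) - (x - d * y)" using dvd_diff by blast
        then have "p dvd 2 * (d * y)" by simp
        then show False using dy p_dvd_mult_iff p_not_dvd_2 by blast
      qed
    qed
    show ?thesis
      unfolding h_def dvd_im4 fac using x0 x1 excl y fac by (auto simp: cong_iff_dvd_diff)
  qed
  have "(\<Sum>x\<in>residues. h x y) = (if p dvd y then p - 1 else 3)" for y
  proof (cases "p dvd y")
    case True
    then show ?thesis by (simp add: y0 sum_residues_if_dvd)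
  next
    case False
    then show ?thesis by (simp add: y1 sum.distrib sum_residues_delta)
  qed
  then have "(\<Sum>y\<in>residues. \<Sum>x\<in>residues. h x y) = (p - 1) + (p - 1) * 3"
    by (simp add: sum_residues_if_dvd)
  moreover have "(\<Sum>u\<in>zresidues. if p dvd im (u ^ 4) then chi (norm2 u * re (u ^ 4)) else 0)
      = (\<Sum>y\<in>residues. \<Sum>x\<in>residues. h x y)"
    unfolding sum_zresidues h_def by (rule sum.swap)
  ultimately show ?thesis by simp
qed

lemma V_sum_eq:
  assumes "chi (-2) = 1" "chi (norm2 c0) = -1"
  shows "V 1 + 2 * V c0 = 16 * p * (p - 1)\<^sup>2"
proof -
  let ?U = "{w \<in> zresidues. unit w}"
  have u0: "unit (c0 ^ n)" for n using assms(2) by (auto simp: unit_def simp flip: chi_eq_0_iff)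
  have per: "zperiodic V" unfolding zperiodic_def using V_cong by blast
  have shift: "(\<Sum>c\<in>zresidues. V (c * c0 ^ n)) = (\<Sum>c\<in>zresidues. V c)" for n
    using sum_zresidues_mult[OF per u0[of n]] by (simp add: mult.commute)
  have "4 * (\<Sum>c\<in>zresidues. V c) =
      (\<Sum>c\<in>zresidues. V c + V (c * c0) + V (c * c0\<^sup>2) + V (c * c0 ^ 3))"
    using shift[of 1] shift[of 2] shift[of 3] by (simp add: sum.distrib)
  also have "\<dots> = (\<Sum>c\<in>zresidues. if unit c then V 1 + 2 * V c0 else 0)"
  proof (intro sum.cong refl)
    fix c
    show "V c + V (c * c0) + V (c * c0\<^sup>2) + V (c * c0 ^ 3) = (if unit c then V 1 + 2 * V c0 else 0)"
      using V_orbit[OF _ assms(2), of c] W_nonunit[OF _ assms(2)] by (auto simp: V_def)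
  qed
  also have "\<dots> = int (card ?U) * (V 1 + 2 * V c0)"
    by (simp flip: sum.inter_filter)
  finally have 1: "4 * (\<Sum>c\<in>zresidues. V c) = int (card ?U) * (V 1 + 2 * V c0)" .
  have "(\<Sum>u\<in>zresidues. chi (norm2 u) * K (u ^ 4)) =
      (\<Sum>u\<in>zresidues. (if p dvd im (u ^ 4) then chi (norm2 u * re (u ^ 4)) else 0) * (p * (p - 1)))"
  proof (intro sum.cong refl)
    fix u
    show "chi (norm2 u) * K (u ^ 4) =
        (if p dvd im (u ^ 4) then chi (norm2 u * re (u ^ 4)) else 0) * (p * (p - 1))"
      by (cases "p dvd im (u ^ 4)") (simp_all only: K_eq[OF assms(2)] chi_mult if_True if_False mult.assoc
          mult_zero_left mult_zero_right)
  qed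
  also have "\<dots> = 4 * (p - 1) * (p * (p - 1))"
    by (simp only: sum_chi_real_fourth_powers[OF assms(1)] flip: sum_distrib_right)
  finally have "4 * (\<Sum>c\<in>zresidues. V c) = int (card ?U) * (16 * p * (p - 1)\<^sup>2)"
    by (simp only: sum_V) (simp add: power2_eq_square)
  with 1[symmetric] have "int (card ?U) * (V 1 + 2 * V c0) = int (card ?U) * (16 * p * (p - 1)\<^sup>2)"
    by (rule trans)
  moreover have "card ?U \<noteq> 0"
  proof -
    have "unit (zred 1)" using unit_zcong[OF zred_zcong, of 1] p_not_dvd_1 by (simp only: unit_def norm2_1 simp_thms)
    then have "zred 1 \<in> ?U" by simp
    moreover have "finite ?U" by simp
    ultimately show ?thesis by (metis (no_types, lifting) card_0_eq empty_iff)
  qed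
  ultimately show ?thesis by (simp only: mult_cancel_left of_nat_eq_0_iff simp_thms)
qed

lemma sum_homogeneous_sextic:
  fixes G :: "int \<Rightarrow> int \<Rightarrow> int"
  assumes hom: "\<And>t x y. G (t * x) (t * y) = t ^ 6 * G x y"
    and cong: "\<And>x x' y y'. [x = x'] (mod p) \<Longrightarrow> [y = y'] (mod p) \<Longrightarrow> [G x y = G x' y'] (mod p)"
  shows "(\<Sum>x\<in>residues. \<Sum>y\<in>residues. chi (G x y)) = (p - 1) * (chi (G 1 0) + (\<Sum>x\<in>residues. chi (G x 1)))"
proof -
  have "(\<Sum>x\<in>residues. chi (G x y)) =
      (if p dvd y then (p - 1) * chi (G 1 0) else (\<Sum>x\<in>residues. chi (G x 1)))" for y
  proof (cases "p dvd y")
    case True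
    have "chi (G x y) = (if p dvd x then 0 else chi (G 1 0))" for x
    proof -
      have "chi (G x y) = chi (G (x * 1) (x * 0))"
        using True by (intro Legendre_cong cong) (simp_all add: cong_0_iff)
      then show ?thesis
        using chi_even_power[of x 6] by (simp only: hom chi_mult chi_power) auto
    qed
    then show ?thesis using True by (simp add: sum_residues_if_dvd)
  next
    case False
    have "(\<Sum>x\<in>residues. chi (G x y)) = (\<Sum>x\<in>residues. chi (G (y * x + 0) y))"
      by (rule sum_residues_linear[symmetric, OF _ False]) (intro periodic_chi_poly cong cong_refl)
    also have "\<dots> = (\<Sum>x\<in>residues. chi (G x 1))"
    proof (intro sum.cong refl)
      fix x
      have "chi (G (y * x + 0) y) = chi (G (y * x) (y * 1))" by simp
      also have "\<dots> = chi (G x 1)"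
        using chi_even_power[OF False, of 6] by (simp only: hom chi_mult chi_power) simp
      finally show "chi (G (y * x + 0) y) = chi (G x 1)" .
    qed
    finally show ?thesis using False by simp
  qed
  moreover have "(\<Sum>x\<in>residues. \<Sum>y\<in>residues. chi (G x y)) = (\<Sum>y\<in>residues. \<Sum>x\<in>residues. chi (G x y))"
    by (rule sum.swap)
  ultimately show ?thesis by (simp add: sum_residues_if_dvd algebra_simps)
qed

lemma W_eq_affine_sum:
  "W c = (p - 1) * (chi (re c) + (\<Sum>x\<in>residues. chi (norm2 (ZSqrt2 x 1) * re (c * ZSqrt2 x 1 ^ 4))))"
proof -
  define G where "G x y = norm2 (ZSqrt2 x y) * re (c * ZSqrt2 x y ^ 4)" for x y
  have "G (t * x) (t * y) = t ^ 6 * G x y" for t x y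
  proof -
    have "ZSqrt2 (t * x) (t * y) = of_int t * ZSqrt2 x y"
      by (simp add: zsqrt2_eq_iff)
    then have "G (t * x) (t * y) = t\<^sup>2 * norm2 (ZSqrt2 x y) * re (of_int (t ^ 4) * (c * ZSqrt2 x y ^ 4))"
      by (simp only: G_def norm2_mult norm2_of_int power_mult_distrib of_int_power mult_ac)
    also have "re (of_int (t ^ 4) * (c * ZSqrt2 x y ^ 4)) = t ^ 4 * re (c * ZSqrt2 x y ^ 4)"
      by (simp del: of_int_power)
    finally show ?thesis by (simp add: G_def flip: power_add)
  qed
  moreover have "[G x y = G x' y'] (mod p)" if "[x = x'] (mod p)" "[y = y'] (mod p)" for x x' y y'
  proof -
    have "ZSqrt2 x y \<approx> ZSqrt2 x' y'" using that by (simp add: zcong_def)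
    then show ?thesis
      unfolding G_def by (intro cong_mult norm2_zcong re_zcong zcong_mult zcong_power zcong_refl)
  qed
  ultimately have "(\<Sum>x\<in>residues. \<Sum>y\<in>residues. chi (G x y)) =
      (p - 1) * (chi (G 1 0) + (\<Sum>x\<in>residues. chi (G x 1)))"
    by (rule sum_homogeneous_sextic)
  moreover have "ZSqrt2 1 0 = 1" by (simp add: zsqrt2_eq_iff)
  ultimately show ?thesis
    unfolding W_def sum_zresidues G_def by simp
qed

lemma sum_square_roots: "(\<Sum>x\<in>residues. if [x\<^sup>2 = s] (mod p) then 1 else 0) = 1 + chi s"
proof (cases "p dvd s")
  case True
  then have "[x\<^sup>2 = s] (mod p) \<longleftrightarrow> p dvd x" for x
    by (metis cong_dvd_iff cong_0_iff cong_sym cong_trans p_dvd_power_iff zero_less_numeral)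
  then show ?thesis using True sum_residues_if_dvd[of 1 0] by simp
next
  case False
  show ?thesis
  proof (cases "QuadRes p s")
    case True
    then obtain y where y: "[y\<^sup>2 = s] (mod p)" by (auto simp: QuadRes_def)
    then have ny: "\<not> p dvd y"
      using False by (metis cong_0_iff cong_sym cong_trans p_dvd_power_iff zero_less_numeral)
    have "(if [x\<^sup>2 = s] (mod p) then 1 else 0) =
        (if [x = y] (mod p) then 1 else 0) + (if [x = -y] (mod p) then 1 else (0::int))" for x
    proof -
      have "[x\<^sup>2 = s] (mod p) \<longleftrightarrow> [x\<^sup>2 = y\<^sup>2] (mod p)"
        using y cong_sym cong_trans by blast
      also have "\<dots> \<longleftrightarrow> p dvd (x - y) * (x + y)"
        by (simp only: cong_iff_dvd_diff) (simp add: power2_eq_square algebra_simps)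
      finally have "[x\<^sup>2 = s] (mod p) \<longleftrightarrow> [x = y] (mod p) \<or> [x = -y] (mod p)"
        by (simp add: cong_iff_dvd_diff)
      moreover have "\<not> ([x = y] (mod p) \<and> [x = -y] (mod p))"
      proof
        assume "[x = y] (mod p) \<and> [x = -y] (mod p)"
        then have "p dvd (x - -y) - (x - y)" unfolding cong_iff_dvd_diff using dvd_diff by blast
        then have "p dvd 2 * y" by simp
        then show False using ny p_dvd_mult_iff p_not_dvd_2 by blast
      qed
      ultimately show ?thesis by auto
    qed
    then show ?thesis using True False
      by (simp add: sum.distrib sum_residues_delta Legendre_def cong_0_iff)
  next
    case nq: False
    then have "\<not> [x\<^sup>2 = s] (mod p)" for x by (auto simp: QuadRes_def)
    then show ?thesis using nq False by (simp add: Legendre_def cong_0_iff)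
  qed
qed

lemma sum_residues_square:
  fixes f :: "int \<Rightarrow> int"
  assumes "periodic f"
  shows "(\<Sum>x\<in>residues. f (x\<^sup>2)) = (\<Sum>s\<in>residues. (1 + chi s) * f s)"
proof -
  have "f (x\<^sup>2) = (\<Sum>s\<in>residues. if [x\<^sup>2 = s] (mod p) then f s else 0)" for x
  proof -
    have "(\<Sum>s\<in>residues. if [x\<^sup>2 = s] (mod p) then f s else 0) =
        (\<Sum>s\<in>residues. f (x\<^sup>2) * (if [s = x\<^sup>2] (mod p) then 1 else 0))"
    proof (intro sum.cong refl)
      fix s
      have "[s = x\<^sup>2] (mod p) \<longleftrightarrow> [x\<^sup>2 = s] (mod p)" by (rule cong_sym_eq)
      then show "(if [x\<^sup>2 = s] (mod p) then f s else 0) = f (x\<^sup>2) * (if [s = x\<^sup>2] (mod p) then 1 else 0)"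
        using periodicD[OF assms, of "x\<^sup>2" s] by simp
    qed
    then show ?thesis by (simp only: sum_residues_delta mult_1_right flip: sum_distrib_left)
  qed
  then have "(\<Sum>x\<in>residues. f (x\<^sup>2)) =
      (\<Sum>x\<in>residues. \<Sum>s\<in>residues. if [x\<^sup>2 = s] (mod p) then f s else 0)"
    by simp
  also have "\<dots> = (\<Sum>s\<in>residues. \<Sum>x\<in>residues. if [x\<^sup>2 = s] (mod p) then f s else 0)"
    by (rule sum.swap)
  also have "\<dots> = (\<Sum>s\<in>residues. (\<Sum>x\<in>residues. if [x\<^sup>2 = s] (mod p) then 1 else 0) * f s)"
    unfolding sum_distrib_right by (intro sum.cong refl) simp
  finally show ?thesis by (simp only: sum_square_roots)
qed

lemma sum_residues_invert:
  fixes f :: "int \<Rightarrow> 'b::comm_monoid_add"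
  assumes f: "periodic f" and k: "\<not> p dvd k"
  obtains h where "(\<Sum>x\<in>residues. f (h x)) = (\<Sum>x\<in>residues. f x)"
    "\<And>x. p dvd x \<Longrightarrow> p dvd h x" "\<And>x. \<not> p dvd x \<Longrightarrow> [x * h x = k] (mod p)"
proof -
  define h where "h x = k * x ^ nat (p - 2)" for x
  have h0: "p dvd h x" if "p dvd x" for x
    using that p_gt_2 by (simp add: h_def)
  have h1: "[x * h x = k] (mod p)" if "\<not> p dvd x" for x
  proof -
    have "odd p" using prime_p p_gt_2 by (simp add: prime_odd_int)
    then have "2 * nat ((p - 1) div 2) = Suc (nat (p - 2))"
      using p_gt_2 by (auto elim!: oddE simp: nat_diff_distrib)
    then have "x * x ^ nat (p - 2) = (x ^ nat ((p - 1) div 2))\<^sup>2"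
      by (metis power_Suc power_mult mult.commute)
    moreover have "[(x ^ nat ((p - 1) div 2))\<^sup>2 = (chi x)\<^sup>2] (mod p)"
      using euler by (intro cong_pow) (rule cong_sym)
    ultimately have "[k * (x * x ^ nat (p - 2)) = k * 1] (mod p)"
      using chi_square[OF that] by (intro cong_mult) simp_all
    then show ?thesis by (simp add: h_def mult_ac)
  qed
  have "(\<Sum>x\<in>residues. f (h x)) = (\<Sum>x\<in>residues. f x)"
  proof (rule sum_residues_reindex[OF f])
    show "[h x = h y] (mod p)" if "[x = y] (mod p)" for x y
      unfolding h_def using that by (intro cong_mult cong_pow cong_refl)
    show "\<exists>x. [h x = y] (mod p)" for y
    proof (cases "p dvd y")
      case True
      then show ?thesis
        using h0 by (intro exI[of _ y]) (metis cong_0_iff cong_sym cong_trans)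
    next
      case False
      note 1 = h1[OF False]
      have nh: "\<not> p dvd h y"
        using 1 k by (metis cong_0_iff cong_sym cong_trans dvd_mult)
      have "[h y * h (h y) = h y * y] (mod p)"
        using h1[OF nh] 1 by (metis cong_sym cong_trans mult.commute)
      then have "p dvd h y * (h (h y) - y)"
        by (simp only: cong_iff_dvd_diff right_diff_distrib)
      then show ?thesis
        using nh p_dvd_mult_iff unfolding cong_iff_dvd_diff by blast
    qed
  qed
  then show ?thesis using h0 h1 by (rule that)
qed

lemma W_1:
  assumes m2: "chi (-2) = 1"
  shows "W 1 = (p - 1) * (2 * (\<Sum>x\<in>residues. chi (x ^ 3 + 4 * x\<^sup>2 + 2 * x)))"
proof -
  let ?T = "\<Sum>x\<in>residues. chi (x ^ 3 + 4 * x\<^sup>2 + 2 * x)"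
  define g where "g s = (s - 2) * (s\<^sup>2 + 12 * s + 4)" for s :: int
  have cong_g: "[g x = g y] (mod p)" if "[x = y] (mod p)" for x y
    unfolding g_def using that by (intro cong_mult cong_diff cong_add cong_pow cong_refl)
  have per: "periodic (\<lambda>s. chi (g s))"
    using cong_g by (rule periodic_chi_poly)
  have per': "periodic (\<lambda>s. chi (s * g s))"
    using cong_g by (intro periodic_chi_poly cong_mult)
  have sum_g: "(\<Sum>s\<in>residues. chi (g s)) = ?T"
  proof -
    have "\<not> p dvd 2\<^sup>2"
      using p_not_dvd_2 p_dvd_power_iff zero_less_numeral by blast
    then have "(\<Sum>s\<in>residues. chi (g s)) = (\<Sum>s\<in>residues. chi (g (2\<^sup>2 * s + 2)))"
      by (rule sum_residues_linear[OF per, symmetric])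
    also have "\<dots> = ?T"
    proof (intro sum.cong refl)
      fix s
      have "g (2\<^sup>2 * s + 2) = 2 ^ 6 * (s ^ 3 + 4 * s\<^sup>2 + 2 * s)"
        by (simp add: g_def eval_nat_numeral algebra_simps)
      then show "chi (g (2\<^sup>2 * s + 2)) = chi (s ^ 3 + 4 * s\<^sup>2 + 2 * s)"
        using chi_even_power[OF p_not_dvd_2, of 6] by (simp only: chi_mult chi_power) simp
    qed
    finally show ?thesis .
  qed
  have p4: "chi 4 = 1"
    using chi_even_power[OF p_not_dvd_2, of 2] chi_power[of 2 2] by simp
  have g0: "chi (g s) = 1" if "p dvd s" for s
  proof -
    have "chi (g s) = chi (g 0)"
      using that by (intro Legendre_cong cong_g) (simp add: cong_0_iff)
    also have "g 0 = (-2) * 4" by (simp add: g_def)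
    finally show ?thesis using m2 p4 by (simp only: chi_mult mult_1)
  qed
  \<comment> \<open>The substitution s = 4 / t exchanges the quartic s * g s and the cubic g t.\<close>
  have sum_sg: "(\<Sum>s\<in>residues. chi (s * g s)) = ?T - 1"
  proof -
    have "\<not> p dvd 4" using p4 chi_eq_0_iff by (metis zero_neq_one)
    then obtain h where h: "(\<Sum>x\<in>residues. chi (h x * g (h x))) = (\<Sum>x\<in>residues. chi (x * g x))"
      "\<And>x. p dvd x \<Longrightarrow> p dvd h x" "\<And>x. \<not> p dvd x \<Longrightarrow> [x * h x = 4] (mod p)"
      using sum_residues_invert[OF per'] by blast
    have "chi (h s * g (h s)) = chi (g s) - (if p dvd s then 1 else 0)" for s
    proof (cases "p dvd s")
      case True
      then have "chi (h s * g (h s)) = 0" using h(2) by simp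
      with True g0 show ?thesis by simp
    next
      case False
      define t where "t = h s"
      have st: "[s * t = 4] (mod p)" using h(3)[OF False] by (simp add: t_def)
      have "chi (t * g t) = chi (s ^ 4 * (t * g t))"
        using chi_even_power[OF False, of 4] by (simp only: chi_mult chi_power) simp
      also have "s ^ 4 * (t * g t) = (s * t) * (s * t - 2 * s) * ((s * t)\<^sup>2 + 12 * s * (s * t) + 4 * s\<^sup>2)"
        by (simp add: g_def eval_nat_numeral algebra_simps)
      also have "chi \<dots> = chi (4 * (4 - 2 * s) * (4\<^sup>2 + 12 * s * 4 + 4 * s\<^sup>2))"
        by (intro Legendre_cong cong_mult cong_diff cong_add cong_pow cong_refl st)
      also have "4 * (4 - 2 * s) * (4\<^sup>2 + 12 * s * 4 + 4 * s\<^sup>2) = 4 * 4 * (-2) * g s"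
        by (simp add: g_def eval_nat_numeral algebra_simps)
      also have "chi \<dots> = chi (g s)"
        using m2 p4 by (simp only: chi_mult mult_1)
      finally show ?thesis using False by (simp add: t_def)
    qed
    then have "(\<Sum>s\<in>residues. chi (s * g s)) =
        (\<Sum>s\<in>residues. chi (g s)) - (\<Sum>s\<in>residues. if p dvd s then 1 else 0)"
      by (simp only: flip: h(1) sum_subtractf)
    then show ?thesis using sum_residues_if_dvd[of 1 0] by (simp only: sum_g mult_zero_right add_0_right)
  qed
  have "norm2 (ZSqrt2 x 1) * re (1 * ZSqrt2 x 1 ^ 4) = g (x\<^sup>2)" for x
    by (simp add: norm2_def g_def eval_nat_numeral algebra_simps)
  then have "W 1 = (p - 1) * (chi 1 + (\<Sum>x\<in>residues. chi (g (x\<^sup>2))))"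
    unfolding W_eq_affine_sum[of 1] by simp
  also have "(\<Sum>x\<in>residues. chi (g (x\<^sup>2))) = (\<Sum>s\<in>residues. chi (g s) + chi (s * g s))"
    unfolding sum_residues_square[OF per] by (intro sum.cong refl) (simp add: algebra_simps)
  also have "\<dots> = 2 * ?T - 1"
    by (simp only: sum.distrib sum_g sum_sg)
  finally show ?thesis by simp
qed

lemma eight_p_eq_sum_of_squares:
  assumes "chi (-2) = 1" "chi (norm2 c0) = -1"
    and V: "V c0 = (p - 1)\<^sup>2 * S\<^sup>2"
  shows "2 * (\<Sum>x\<in>residues. chi (x ^ 3 + 4 * x\<^sup>2 + 2 * x))\<^sup>2 + S\<^sup>2 = 8 * p"
proof -
  define T where "T = (\<Sum>x\<in>residues. chi (x ^ 3 + 4 * x\<^sup>2 + 2 * x))"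
  have "V 1 = (p - 1)\<^sup>2 * (4 * T\<^sup>2)"
    using W_1[OF assms(1)] by (simp add: V_def power_mult_distrib flip: T_def)
  then have "(p - 1)\<^sup>2 * (4 * T\<^sup>2 + 2 * S\<^sup>2) = (p - 1)\<^sup>2 * (16 * p)"
    using V_sum_eq[OF assms(1,2)] V by (simp add: distrib_left mult_ac)
  moreover have "(p - 1)\<^sup>2 \<noteq> 0" using p_gt_2 by simp
  ultimately have "4 * T\<^sup>2 + 2 * S\<^sup>2 = 16 * p"
    by (metis mult_cancel_left)
  then show ?thesis by (simp flip: T_def)
qed

lemma V_eq_sextic_sum:
  assumes "chi 2 = -1"
  shows "V (ZSqrt2 2 1) = (p - 1)\<^sup>2 *
    (1 + (\<Sum>x\<in>residues. chi (x ^ 6 + 4 * x ^ 5 + 10 * x ^ 4 - 20 * x\<^sup>2 - 16 * x - 8)))\<^sup>2"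
proof -
  let ?f = "\<lambda>x::int. x ^ 6 + 4 * x ^ 5 + 10 * x ^ 4 - 20 * x\<^sup>2 - 16 * x - 8"
  have "norm2 (ZSqrt2 x 1) * re (ZSqrt2 2 1 * ZSqrt2 x 1 ^ 4) = 2 * ?f x" for x
    by (simp add: norm2_def eval_nat_numeral algebra_simps)
  then have "W (ZSqrt2 2 1) = (p - 1) * (chi 2 + (\<Sum>x\<in>residues. chi (2 * ?f x)))"
    unfolding W_eq_affine_sum[of "ZSqrt2 2 1"] by simp
  also have "\<dots> = (p - 1) * - (1 + (\<Sum>x\<in>residues. chi (?f x)))"
    by (simp only: chi_mult assms flip: sum_distrib_left) simp
  finally show ?thesis
    by (simp only: V_def power_mult_distrib power2_minus)
qed

lemma V_eq_quintic_sum: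
  assumes r: "[r\<^sup>2 = 2] (mod p)"
  shows "V (ZSqrt2 (r * (1 + n)) (1 - n)) = (p - 1)\<^sup>2 * (\<Sum>x\<in>residues. chi (x ^ 5 + n * x))\<^sup>2"
proof -
  define G where "G x y = x * y * (x ^ 4 + n * y ^ 4)" for x y :: int
  have cong_G: "[G x y = G x' y'] (mod p)" if "[x = x'] (mod p)" "[y = y'] (mod p)" for x x' y y'
    unfolding G_def using that by (intro cong_mult cong_add cong_pow cong_refl)
  have nr: "\<not> p dvd r"
    using r p_not_dvd_2 by (metis cong_0_iff cong_sym cong_trans p_dvd_power_iff zero_less_numeral)
  have "W (ZSqrt2 (r * (1 + n)) (1 - n)) =
      (\<Sum>x\<in>residues. \<Sum>y\<in>residues. chi r * chi (G (x + r * y) (x - r * y)))"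
    unfolding W_def sum_zresidues
  proof (intro sum.cong refl)
    fix x y :: int
    have r2: "p dvd r\<^sup>2 - 2" using r by (simp add: cong_iff_dvd_diff)
    define A where "A = x ^ 4 + 12 * x\<^sup>2 * y\<^sup>2 + 4 * y ^ 4"
    define B where "B = 4 * x ^ 3 * y + 8 * x * y ^ 3"
    have re: "re (ZSqrt2 (r * (1 + n)) (1 - n) * ZSqrt2 x y ^ 4) = r * (1 + n) * A + 2 * (1 - n) * B"
      by (simp add: A_def B_def eval_nat_numeral algebra_simps)
    have "[norm2 (ZSqrt2 x y) = (x + r * y) * (x - r * y)] (mod p)"
    proof -
      have "norm2 (ZSqrt2 x y) - (x + r * y) * (x - r * y) = (r\<^sup>2 - 2) * y\<^sup>2"
        by (simp add: norm2_def power2_eq_square algebra_simps)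
      then show ?thesis using r2 by (simp add: cong_iff_dvd_diff)
    qed
    moreover have "[r * (1 + n) * A + 2 * (1 - n) * B = r * ((x + r * y) ^ 4 + n * (x - r * y) ^ 4)] (mod p)"
    proof -
      have "r * (1 + n) * A + 2 * (1 - n) * B - r * ((x + r * y) ^ 4 + n * (x - r * y) ^ 4) =
          - ((r\<^sup>2 - 2) * (r * (1 + n) * (6 * x\<^sup>2 * y\<^sup>2 + (r\<^sup>2 + 2) * y ^ 4) +
             (1 - n) * (4 * x ^ 3 * y + 4 * (r\<^sup>2 + 2) * x * y ^ 3)))"
        by (simp add: A_def B_def eval_nat_numeral algebra_simps)
      then show ?thesis using r2 by (simp add: cong_iff_dvd_diff)
    qed
    ultimately have "[norm2 (ZSqrt2 x y) * re (ZSqrt2 (r * (1 + n)) (1 - n) * ZSqrt2 x y ^ 4)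
        = (x + r * y) * (x - r * y) * (r * ((x + r * y) ^ 4 + n * (x - r * y) ^ 4))] (mod p)"
      unfolding re by (rule cong_mult)
    also have "(x + r * y) * (x - r * y) * (r * ((x + r * y) ^ 4 + n * (x - r * y) ^ 4)) =
        r * G (x + r * y) (x - r * y)"
      by (simp only: G_def mult_ac)
    finally show "chi (norm2 (ZSqrt2 x y) * re (ZSqrt2 (r * (1 + n)) (1 - n) * ZSqrt2 x y ^ 4)) =
        chi r * chi (G (x + r * y) (x - r * y))"
      by (simp only: Legendre_cong flip: chi_mult)
  qed
  also have "\<dots> = chi r * (\<Sum>x\<in>residues. \<Sum>y\<in>residues. chi (G (x + r * y) (x - r * y)))"
    by (simp only: sum_distrib_left)
  also have "(\<Sum>x\<in>residues. \<Sum>y\<in>residues. chi (G (x + r * y) (x - r * y))) =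
      (\<Sum>y\<in>residues. \<Sum>x\<in>residues. chi (G (x + r * y) (x - r * y)))"
    by (rule sum.swap)
  also have "\<dots> = (\<Sum>y\<in>residues. \<Sum>x\<in>residues. chi (G x (x - 2 * r * y)))"
  proof (rule sum.cong[OF refl])
    fix y
    have "periodic (\<lambda>x. chi (G x (x - 2 * r * y)))"
      by (intro periodic_chi_poly cong_G cong_diff cong_refl)
    from sum_residues_linear[OF this p_not_dvd_1, of "r * y"]
    show "(\<Sum>x\<in>residues. chi (G (x + r * y) (x - r * y))) =
        (\<Sum>x\<in>residues. chi (G x (x - 2 * r * y)))"
      by (simp add: algebra_simps)
  qed
  also have "\<dots> = (\<Sum>x\<in>residues. \<Sum>y\<in>residues. chi (G x (x - 2 * r * y)))"
    by (rule sum.swap)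
  also have "\<dots> = (\<Sum>x\<in>residues. \<Sum>y\<in>residues. chi (G x y))"
  proof (rule sum.cong[OF refl])
    fix x
    have "periodic (\<lambda>y. chi (G x y))"
      by (intro periodic_chi_poly cong_G cong_refl)
    moreover have "\<not> p dvd - (2 * r)"
      using nr p_dvd_mult_iff p_not_dvd_2 dvd_minus_iff by blast
    ultimately have "(\<Sum>y\<in>residues. chi (G x (- (2 * r) * y + x))) = (\<Sum>y\<in>residues. chi (G x y))"
      by (rule sum_residues_linear)
    then show "(\<Sum>y\<in>residues. chi (G x (x - 2 * r * y))) = (\<Sum>y\<in>residues. chi (G x y))"
      by (simp add: algebra_simps)
  qed
  also have "\<dots> = (p - 1) * (chi (G 1 0) + (\<Sum>x\<in>residues. chi (G x 1)))"
    by (rule sum_homogeneous_sextic[OF _ cong_G]) (simp_all add: G_def eval_nat_numeral algebra_simps)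
  also have "\<dots> = (p - 1) * (\<Sum>x\<in>residues. chi (x ^ 5 + n * x))"
  proof -
    have "G x 1 = x ^ 5 + n * x" for x
      by (simp add: G_def eval_nat_numeral algebra_simps)
    moreover have "G 1 0 = 0" by (simp add: G_def)
    ultimately show ?thesis by (simp only: chi_0) simp
  qed
  finally show ?thesis
    by (simp only: V_def power_mult_distrib chi_square[OF nr] mult_1)
qed

lemma chi_supplement:
  assumes "[p = 1] (mod 8) \<or> [p = 3] (mod 8)"
  shows "chi 2 = (if [p = 1] (mod 8) then 1 else -1)" and "chi (-2) = 1"
proof -
  define m where "m = p div 8"
  have m: "p = 8 * m + 1 \<and> [p = 1] (mod 8) \<or> p = 8 * m + 3 \<and> \<not> [p = 1] (mod 8)" and m0: "m \<ge> 0"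
  proof -
    have "p = 8 * m + p mod 8" by (simp add: m_def)
    moreover have "p mod 8 = 1 \<or> p mod 8 = 3" using assms by (simp add: cong_def)
    moreover have "[p = 1] (mod 8) \<longleftrightarrow> p mod 8 = 1" by (simp add: cong_def)
    ultimately show "p = 8 * m + 1 \<and> [p = 1] (mod 8) \<or> p = 8 * m + 3 \<and> \<not> [p = 1] (mod 8)"
      by auto
    show "m \<ge> 0" using p_gt_2 by (simp add: m_def pos_imp_zdiv_nonneg_iff)
  qed
  let ?h = "(p - 1) div 2"
  interpret GAUSS "nat p" 2
  proof
    show "prime (nat p)" "2 < nat p" using prime_p p_gt_2 by auto
    show "[2 \<noteq> 0] (mod int (nat p))" using p_not_dvd_2 p_gt_2 by (simp add: cong_0_iff)
  qed simp
  have p': "int (nat p) = p" using p_gt_2 by simp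
  have "E = (\<lambda>x. 2 * x) ` {2 * m + 1..?h}"
  proof -
    have "C = (\<lambda>x. 2 * x) ` {0<..?h}"
      unfolding C_def B_def A_def p' image_image using p_gt_2
      by (intro image_cong refl) auto
    moreover have "?h < 2 * x \<longleftrightarrow> 2 * m + 1 \<le> x" for x
      using m by auto
    ultimately show ?thesis
      unfolding E_def p' using m0 by auto
  qed
  then have "card E = nat (?h - 2 * m)"
    by (simp add: card_image inj_on_def)
  then have "chi 2 = (-1) ^ nat (?h - 2 * m)"
    using gauss_lemma p' by simp
  moreover have "even (nat (?h - 2 * m)) \<longleftrightarrow> [p = 1] (mod 8)"
    using m m0 by (auto simp: even_nat_iff)
  ultimately show 2: "chi 2 = (if [p = 1] (mod 8) then 1 else -1)"
    by simp
  have "even (nat ?h) \<longleftrightarrow> [p = 1] (mod 8)"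
    using m m0 by (auto simp: even_nat_iff)
  then have "chi (-1) = (if [p = 1] (mod 8) then 1 else -1)"
    by (simp add: chi_minus_1)
  moreover have "chi (-2) = chi (-1) * chi 2"
    using chi_mult[of "-1" 2] by simp
  ultimately show "chi (-2) = 1"
    using 2 by simp
qed

end

lemma half_quarter_sum_of_squares:
  fixes S T :: int and p :: int
  assumes "2 * T\<^sup>2 + S\<^sup>2 = 8 * p"
  shows "1/2 * of_int T \<in> (\<int> :: rat set)" "1/4 * of_int S \<in> (\<int> :: rat set)"
    "(1/2 * of_int T)\<^sup>2 + 2 * (1/4 * of_int S)\<^sup>2 = (of_int p :: rat)"
proof -
  have "S\<^sup>2 = 2 * (4 * p - T\<^sup>2)" using assms by simp
  then have "even (S\<^sup>2)" by (metis dvd_triv_left)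
  then obtain S1 where S1: "S = 2 * S1" by (auto elim: evenE)
  then have eq1: "T\<^sup>2 = 2 * (2 * p - S1\<^sup>2)" using assms by (simp add: power_mult_distrib)
  then have "even (T\<^sup>2)" by (metis dvd_triv_left)
  then obtain A where A: "T = 2 * A" by (auto elim: evenE)
  then have eq2: "S1\<^sup>2 = 2 * (p - A\<^sup>2)" using eq1 by (simp add: power_mult_distrib)
  then have "even (S1\<^sup>2)" by (metis dvd_triv_left)
  then obtain B where B: "S1 = 2 * B" by (auto elim: evenE)
  then have eq3: "A\<^sup>2 + 2 * B\<^sup>2 = p" using eq2 by (simp add: power_mult_distrib)
  have a: "1/2 * of_int T = (of_int A :: rat)" and b: "1/4 * of_int S = (of_int B :: rat)"
    using A B S1 by simp_all
  show "1/2 * of_int T \<in> (\<int> :: rat set)" "1/4 * of_int S \<in> (\<int> :: rat set)"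
    unfolding a b by simp_all
  show "(1/2 * of_int T)\<^sup>2 + 2 * (1/4 * of_int S)\<^sup>2 = (of_int p :: rat)"
    unfolding a b by (simp flip: eq3)
qed

theorem theorem1p3:
  fixes p :: int and A :: rat
  assumes "prime p"
    and "[p = 1] (mod 8) \<or> [p = 3] (mod 8)"
    and "A = 1/2 * of_int (\<Sum>x=0..p-1. Legendre (x^3 + 4*x^2 + 2*x) p)"
  shows "([p = 1] (mod 8) \<longrightarrow>
           (\<forall>(n::int) (B::rat). \<not> QuadRes p n \<longrightarrow>
              B = 1/4 * of_int (\<Sum>x=0..p-1. Legendre (x^5 + n*x) p) \<longrightarrow>
              A \<in> \<int> \<and> B \<in> \<int> \<and> A^2 + 2 * B^2 = of_int p)) \<and>
         ([p = 3] (mod 8) \<longrightarrow>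
           (\<forall>B::rat.
              B = 1/4 * (1 + of_int (\<Sum>x=0..p-1.
                    Legendre (x^6 + 4*x^5 + 10*x^4 - 20*x^2 - 16*x - 8) p)) \<longrightarrow>
              A \<in> \<int> \<and> B \<in> \<int> \<and> A^2 + 2 * B^2 = of_int p))"
proof -
  have "p \<noteq> 2" using assms(2) by (auto simp: cong_def)
  then interpret odd_prime p
    using assms(1) prime_ge_2_int[of p] by unfold_locales auto
  note two = chi_supplement(1)[OF assms(2)] and m2 = chi_supplement(2)[OF assms(2)]
  show ?thesis
  proof (intro conjI impI allI)
    fix n :: int and B :: rat
    assume p1: "[p = 1] (mod 8)" and n: "\<not> QuadRes p n"
      and B: "B = 1/4 * of_int (\<Sum>x=0..p-1. Legendre (x^5 + n*x) p)"
    have "QuadRes p 2" using two p1 by (auto simp: Legendre_def split: if_splits)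
    then obtain r where r: "[r\<^sup>2 = 2] (mod p)" by (auto simp: QuadRes_def)
    have "\<not> [n = 0] (mod p)"
      using n unfolding QuadRes_def by (metis cong_sym zero_power2)
    then have chi_n: "chi n = -1" using n by (simp add: Legendre_def)
    have "chi (norm2 (ZSqrt2 (r * (1 + n)) (1 - n))) = chi (2 ^ 3 * n)"
    proof (intro Legendre_cong)
      have "norm2 (ZSqrt2 (r * (1 + n)) (1 - n)) - 2 ^ 3 * n = (r\<^sup>2 - 2) * (1 + n)\<^sup>2"
        by (simp add: norm2_def power2_eq_square algebra_simps)
      then show "[norm2 (ZSqrt2 (r * (1 + n)) (1 - n)) = 2 ^ 3 * n] (mod p)"
        using r by (simp add: cong_iff_dvd_diff)
    qed
    also have "\<dots> = -1"
      using two p1 chi_n by (simp only: chi_mult chi_power) simp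
    finally have eq: "2 * (\<Sum>x=0..p-1. Legendre (x^3 + 4*x^2 + 2*x) p)\<^sup>2 +
        (\<Sum>x=0..p-1. Legendre (x^5 + n*x) p)\<^sup>2 = 8 * p"
      by (rule eight_p_eq_sum_of_squares[OF m2 _ V_eq_quintic_sum[OF r]])
    show "A \<in> \<int>" "B \<in> \<int>" "A^2 + 2 * B^2 = of_int p"
      unfolding assms(3) B by (fact half_quarter_sum_of_squares[OF eq])+
  next
    fix B :: rat
    assume p3: "[p = 3] (mod 8)"
      and B: "B = 1/4 * (1 + of_int (\<Sum>x=0..p-1.
                    Legendre (x^6 + 4*x^5 + 10*x^4 - 20*x^2 - 16*x - 8) p))"
    let ?S = "\<Sum>x=0..p-1. Legendre (x^6 + 4*x^5 + 10*x^4 - 20*x^2 - 16*x - 8) p"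
    have chi2: "chi 2 = -1" using two p3 by (auto simp: cong_def)
    then have "chi (norm2 (ZSqrt2 2 1)) = -1" by (simp add: norm2_def)
    then have eq: "2 * (\<Sum>x=0..p-1. Legendre (x^3 + 4*x^2 + 2*x) p)\<^sup>2 + (1 + ?S)\<^sup>2 = 8 * p"
      by (rule eight_p_eq_sum_of_squares[OF m2 _ V_eq_sextic_sum[OF chi2]])
    have B': "B = 1/4 * of_int (1 + ?S)" using B by simp
    show "A \<in> \<int>" "B \<in> \<int>" "A^2 + 2 * B^2 = of_int p"
      unfolding assms(3) B' by (fact half_quarter_sum_of_squares[OF eq])+
  qed
qed

end
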